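(* Let $\mu>0$ and $v=1$. Let $\alpha$ be a constant-speed ramp with velocity $1$ for the inverse central harmonic oscillator $\mathbf{F}(\mathbf{r})=-m\,\mathbf{r}/r^2$ with friction coefficient $\mu$. Then the TreadmillSled of $\alpha$ is either a point of the $\xi_2$-axis $\{(0,a):a\neq 0\}$ or (part of) a logarithmic spiral. When the TreadmillSled is (part of) a logarithmic spiral, then, up to a rotation about the origin, a dilation centered at the origin, and an orientation-preserving reparametrization, $\alpha$ is (a restriction to a subinterval of) the curve $$\alpha(t)=e^{-\mu t}\left(\cos\left(\mu\log\frac{\cos(t+u)}{\cos u}\right),\ \sin\left(\mu\log\frac{\cos(t+u)}{\cos u}\right)\right),\qquad t\in\left(\tfrac{\pi}{2}-u,\tfrac{3\pi}{2}-u\right),$$ for some $u\in(\pi/2,3\pi/2)$.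
   Context: Let $J(x,y)=(-y,x)$. For a smooth curve $\alpha:I\to\mathbb{R}^2\setminus\{0\}$ parametrized by arc-length, $\mathbf{n}(s)=J\alpha'(s)$ and $\kappa(s)=\langle\alpha''(s),\mathbf{n}(s)\rangle$. An arc-length parametrized curve $\alpha$ is a constant-speed ramp with velocity $v$ for the inverse central harmonic oscillator and kinetic friction coefficient $\mu>0$ if for all $s\in I$: $\langle\alpha(s),\alpha'(s)\rangle\le 0$ and $$\kappa(s)=-\frac{1}{v^2|\alpha(s)|^2}\left(\frac{\langle\alpha(s),\alpha'(s)\rangle}{\mu}+\langle\alpha(s),\mathbf{n}(s)\rangle\right).$$ The TreadmillSled of an arc-length parametrized curve $\alpha$ is the plane curve $\gamma(s)=(\xi_1(s),\xi_2(s))=-(\langle\alpha(s),\alpha'(s)\rangle,\langle\alpha(s),\mathbf{n}(s)\rangle)$; for a regular curve it is defined via an orientation-preserving arc-length reparametrization. A logarithmic spiral is a curve which in polar coordinates $(\rho,\theta)$ about the origin is given by $\rho=c\,e^{b\theta}$, with $c>0$, $b\neq 0$. *)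

theory Defs
  imports "HOL-Analysis.Analysis"
begin

text \<open>
  The plane is \<^typ>\<open>real \<times> real\<close>, whose inner product and norm are the Euclidean ones.
  All derivatives are taken within the parameter interval, so they are one-sided at an end point
  that belongs to it.
\<close>

definition nondegenerate_interval :: "real set \<Rightarrow> bool" where
  "nondegenerate_interval I \<longleftrightarrow> is_interval I \<and> interior I \<noteq> {}"

text \<open>\<open>C\<^sup>\<infinity>\<close>: the function \<open>D n\<close> is the \<open>n\<close>-th derivative of \<open>f\<close>.\<close>

definition smooth_curve_on :: "real set \<Rightarrow> (real \<Rightarrow> 'a::real_normed_vector) \<Rightarrow> bool" where
  "smooth_curve_on I f \<longleftrightarrow>
     (\<exists>D :: nat \<Rightarrow> real \<Rightarrow> 'a.
        (\<forall>s\<in>I. D 0 s = f s) \<and>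
        (\<forall>n. \<forall>s\<in>I. (D n has_vector_derivative D (Suc n) s) (at s within I)))"

definition velocity :: "real set \<Rightarrow> (real \<Rightarrow> 'a::real_normed_vector) \<Rightarrow> real \<Rightarrow> 'a" where
  "velocity I f s = vector_derivative f (at s within I)"

definition J :: "real \<times> real \<Rightarrow> real \<times> real" where
  "J p = (- snd p, fst p)"

definition unit_normal :: "real set \<Rightarrow> (real \<Rightarrow> real \<times> real) \<Rightarrow> real \<Rightarrow> real \<times> real" where
  "unit_normal I \<alpha> s = J (velocity I \<alpha> s)"

definition curvature :: "real set \<Rightarrow> (real \<Rightarrow> real \<times> real) \<Rightarrow> real \<Rightarrow> real" where
  "curvature I \<alpha> s = velocity I (velocity I \<alpha>) s \<bullet> unit_normal I \<alpha> s"

definition arclength_curve :: "real set \<Rightarrow> (real \<Rightarrow> real \<times> real) \<Rightarrow> bool" where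
  "arclength_curve I \<alpha> \<longleftrightarrow>
     nondegenerate_interval I \<and> smooth_curve_on I \<alpha> \<and>
     (\<forall>s\<in>I. \<alpha> s \<noteq> 0) \<and> (\<forall>s\<in>I. norm (velocity I \<alpha> s) = 1)"

text \<open>
  Constant-speed ramps with velocity \<open>v\<close> for the force field \<open>F(r) = - m r / |r|\<^sup>2\<close>
  with kinetic friction coefficient \<open>\<mu>\<close>; the mass cancels from the equation of motion.
\<close>

definition inverse_oscillator_ramp ::
    "real \<Rightarrow> real \<Rightarrow> real set \<Rightarrow> (real \<Rightarrow> real \<times> real) \<Rightarrow> bool" where
  "inverse_oscillator_ramp v \<mu> I \<alpha> \<longleftrightarrow>
     arclength_curve I \<alpha> \<and>
     (\<forall>s\<in>I. \<alpha> s \<bullet> velocity I \<alpha> s \<le> 0 \<and>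
        curvature I \<alpha> s =
          - (1 / (v\<^sup>2 * (norm (\<alpha> s))\<^sup>2)) *
            ((\<alpha> s \<bullet> velocity I \<alpha> s) / \<mu> + \<alpha> s \<bullet> unit_normal I \<alpha> s))"

definition treadmill_sled ::
    "real set \<Rightarrow> (real \<Rightarrow> real \<times> real) \<Rightarrow> real \<Rightarrow> real \<times> real" where
  "treadmill_sled I \<alpha> s = - (\<alpha> s \<bullet> velocity I \<alpha> s, \<alpha> s \<bullet> unit_normal I \<alpha> s)"

text \<open>
  Changes of parameter from an interval \<open>I\<close> onto an interval \<open>K\<close>. As the derivative has no zero,
  the inverse function is smooth too.
\<close>

definition reparametrization :: "real set \<Rightarrow> real set \<Rightarrow> (real \<Rightarrow> real) \<Rightarrow> bool" where
  "reparametrization I K h \<longleftrightarrow>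
     nondegenerate_interval I \<and> nondegenerate_interval K \<and> bij_betw h I K \<and>
     smooth_curve_on I h \<and> (\<forall>s\<in>I. velocity I h s \<noteq> 0)"

definition orientation_preserving_reparametrization ::
    "real set \<Rightarrow> real set \<Rightarrow> (real \<Rightarrow> real) \<Rightarrow> bool" where
  "orientation_preserving_reparametrization I K h \<longleftrightarrow>
     reparametrization I K h \<and> (\<forall>s\<in>I. velocity I h s > 0)"

definition log_spiral :: "real \<Rightarrow> real \<Rightarrow> real \<Rightarrow> real \<times> real" where
  "log_spiral c b \<theta> = (c * exp (b * \<theta>)) *\<^sub>R (cos \<theta>, sin \<theta>)"

text \<open>
  The curve \<open>\<gamma>\<close> on \<open>I\<close> runs regularly, in either direction, through the arc of a logarithmic
  spiral over some interval \<open>K\<close> of polar angles (possibly the whole line). Constant curves are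
  excluded because \<open>K\<close> is nondegenerate.
\<close>

definition part_of_log_spiral :: "real set \<Rightarrow> (real \<Rightarrow> real \<times> real) \<Rightarrow> bool" where
  "part_of_log_spiral I \<gamma> \<longleftrightarrow>
     (\<exists>c b K \<theta>. c > 0 \<and> b \<noteq> 0 \<and> reparametrization I K \<theta> \<and>
        (\<forall>s\<in>I. \<gamma> s = log_spiral c b (\<theta> s)))"

definition rotation :: "real \<Rightarrow> real \<times> real \<Rightarrow> real \<times> real" where
  "rotation \<phi> p =
     (cos \<phi> * fst p - sin \<phi> * snd p, sin \<phi> * fst p + cos \<phi> * snd p)"

definition model_ramp :: "real \<Rightarrow> real \<Rightarrow> real \<Rightarrow> real \<times> real" where
  "model_ramp \<mu> u t =
     exp (- \<mu> * t) *\<^sub>R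
       (cos (\<mu> * ln (cos (t + u) / cos u)), sin (\<mu> * ln (cos (t + u) / cos u)))"

end

theory Submission
  imports Defs
begin

text \<open>
  Identify the plane with the complex numbers. By the Frenet equations the TreadmillSled
  \<open>z = x + i y\<close> of a ramp satisfies \<open>z' = - q (1 + i / \<mu>) z\<close> with \<open>q = x / |z|\<^sup>2\<close>. The equation for
  \<open>x\<close> is linear homogeneous, so \<open>x\<close> vanishes identically or nowhere. In the first case \<open>z\<close> is
  constant. In the second case \<open>x > 0\<close>, the polar angle is \<open>\<theta> = arctan (y / x)\<close> with
  \<open>\<theta>' = - q / \<mu> < 0\<close>, and \<open>|z| e\<^bsup>- \<mu> \<theta>\<^esup>\<close> is constant: a logarithmic spiral. Moreover \<open>|\<alpha>| = |z|\<close>, and the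
  polar angle of \<open>\<alpha>\<close> has the derivative \<open>y / |z|\<^sup>2 = (\<mu> ln (cos \<theta>))'\<close>, so \<open>\<alpha>\<close> is the model ramp with
  \<open>u = \<pi>\<close> at the time \<open>t = - \<theta>\<close>.
\<close>

section \<open>Smoothness of solutions of polynomial differential equations\<close>

text \<open>Choosing one derivative inside \<open>P\<close> for each member gives an operator
  \<open>d\<close>; its iterates at \<open>f\<close> form the sequence that
  \<open>smooth_curve_on\<close> asks for.\<close>

lemma smooth_curve_on_coinduct:
  assumes "f \<in> P"
    and step: "\<And>f. f \<in> P \<Longrightarrow> \<exists>g\<in>P. \<forall>s\<in>I. (f has_vector_derivative g s) (at s within I)"
  shows "smooth_curve_on I f"
proof -
  obtain d where d: "\<And>f. f \<in> P \<Longrightarrow> d f \<in> P"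
    "\<And>f s. f \<in> P \<Longrightarrow> s \<in> I \<Longrightarrow> (f has_vector_derivative d f s) (at s within I)"
    using step by metis
  have mem: "(d ^^ n) f \<in> P" for n
    by (induction n) (use d assms(1) in auto)
  show ?thesis
    unfolding smooth_curve_on_def
    by (rule exI[of _ "\<lambda>n. (d ^^ n) f"]) (use d mem in auto)
qed

text \<open>The derivative sequence of \<open>g\<close>, shifted by one and with \<open>f\<close>
  put in front, serves \<open>f\<close>. It reduces the polar angle, an arctangent, to its rational
  derivative.\<close>

lemma smooth_curve_on_antiderivative:
  assumes "smooth_curve_on I g"
    and "\<And>s. s \<in> I \<Longrightarrow> (f has_vector_derivative g s) (at s within I)"
  shows "smooth_curve_on I f"
proof -
  obtain D where D: "\<forall>s\<in>I. D 0 s = g s"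
    "\<And>n s. s \<in> I \<Longrightarrow> (D n has_vector_derivative D (Suc n) s) (at s within I)"
    using assms(1) unfolding smooth_curve_on_def by blast
  show ?thesis
    unfolding smooth_curve_on_def
    by (rule exI[of _ "\<lambda>n. case n of 0 \<Rightarrow> f | Suc m \<Rightarrow> D m"])
      (use D assms(2) in \<open>auto split: nat.split\<close>)
qed

text \<open>This is the real algebra generated by \<open>G\<close>. Quotients are reached by
  adjoining a reciprocal as a further generator.\<close>

inductive_set polynomials_in :: "('a \<Rightarrow> real) set \<Rightarrow> ('a \<Rightarrow> real) set"
  for G :: "('a \<Rightarrow> real) set" where
  generator: "g \<in> G \<Longrightarrow> g \<in> polynomials_in G"
| const: "(\<lambda>_. c) \<in> polynomials_in G"
| add: "f \<in> polynomials_in G \<Longrightarrow> g \<in> polynomials_in G \<Longrightarrow> (\<lambda>s. f s + g s) \<in> polynomials_in G"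
| mult: "f \<in> polynomials_in G \<Longrightarrow> g \<in> polynomials_in G \<Longrightarrow> (\<lambda>s. f s * g s) \<in> polynomials_in G"

text \<open>The sum and product rules close the algebra under differentiation once the derivatives
  of the generators lie in it, so it can serve as the class \<open>P\<close> of the
  coinduction.\<close>

lemma smooth_curve_on_polynomials_in:
  assumes gen: "\<And>g. g \<in> G \<Longrightarrow>
      \<exists>g'\<in>polynomials_in G. \<forall>s\<in>I. (g has_real_derivative g' s) (at s within I)"
    and f: "f \<in> polynomials_in G"
  shows "smooth_curve_on I f"
proof (rule smooth_curve_on_coinduct[OF f])
  fix f assume "f \<in> polynomials_in G"
  then have "\<exists>g\<in>polynomials_in G. \<forall>s\<in>I. (f has_real_derivative g s) (at s within I)"
  proof induction
    case (generator g)
    then show ?case by (rule gen)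
  next
    case (const c)
    show ?case
      by (rule bexI[of _ "\<lambda>_. 0"]) (auto intro: polynomials_in.const)
  next
    case (add f g)
    then obtain f' g' where "f' \<in> polynomials_in G" "g' \<in> polynomials_in G"
      "\<forall>s\<in>I. (f has_real_derivative f' s) (at s within I)"
      "\<forall>s\<in>I. (g has_real_derivative g' s) (at s within I)"
      by blast
    then show ?case
      by (intro bexI[of _ "\<lambda>s. f' s + g' s"])
        (auto intro!: derivative_eq_intros polynomials_in.add)
  next
    case (mult f g)
    then obtain f' g' where "f' \<in> polynomials_in G" "g' \<in> polynomials_in G"
      "\<forall>s\<in>I. (f has_real_derivative f' s) (at s within I)"
      "\<forall>s\<in>I. (g has_real_derivative g' s) (at s within I)"
      by blast
    with mult.hyps show ?case
      by (intro bexI[of _ "\<lambda>s. f' s * g s + g' s * f s"])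
        (auto intro!: DERIV_mult polynomials_in.add polynomials_in.mult)
  qed
  then show "\<exists>g\<in>polynomials_in G. \<forall>s\<in>I. (f has_vector_derivative g s) (at s within I)"
    by (simp add: has_real_derivative_iff_has_vector_derivative)
qed

section \<open>Calculus on nondegenerate intervals\<close>

lemma nondegenerate_interval_two_points:
  assumes "nondegenerate_interval I"
  obtains a b where "a \<in> I" "b \<in> I" "a < b"
proof -
  obtain x where "x \<in> interior I"
    using assms unfolding nondegenerate_interval_def by blast
  then obtain e where e: "e > 0" "cball x e \<subseteq> I"
    using mem_interior_cball by metis
  then have "x \<in> I" "x + e \<in> I"
    by (auto simp: subset_iff dist_real_def)
  with e(1) that show ?thesis by (meson less_add_same_cancel1)
qed

lemma nondegenerate_intervalI:
  assumes "is_interval I" "a \<in> I" "b \<in> I" "a < (b::real)"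
  shows "nondegenerate_interval I"
proof -
  have "{a<..<b} \<subseteq> interior I"
    using mem_is_interval_1_I[OF assms(1-3)] by (intro interior_maximal) auto
  moreover have "(a + b) / 2 \<in> {a<..<b}"
    using assms(4) by simp
  ultimately show ?thesis
    using assms(1) unfolding nondegenerate_interval_def by blast
qed

text \<open>A connected set with two points has no isolated point. This makes derivatives within
  \<open>I\<close> unique, so that \<open>velocity\<close> can be computed.\<close>

lemma nondegenerate_interval_at_within:
  assumes "nondegenerate_interval I" "s \<in> I"
  shows "at s within I \<noteq> bot"
proof -
  obtain a b where ab: "a \<in> I" "b \<in> I" "a < b"
    using nondegenerate_interval_two_points[OF assms(1)] .
  have "I \<noteq> {s}"
    using ab by auto
  moreover have "connected I"
    using assms(1) by (simp add: nondegenerate_interval_def is_interval_connected)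
  ultimately show ?thesis
    using assms(2) connected_imp_perfect[of I s] by (auto simp: trivial_limit_within)
qed

lemma velocity_eq:
  assumes "nondegenerate_interval I" "s \<in> I"
    and "(f has_vector_derivative f') (at s within I)"
  shows "velocity I f s = f'"
  unfolding velocity_def
  using vector_derivative_within[OF nondegenerate_interval_at_within[OF assms(1,2)] assms(3)] .

lemma velocity_eq_real:
  assumes "nondegenerate_interval I" "s \<in> I"
    and "(f has_real_derivative f') (at s within I)"
  shows "velocity I f s = f'"
  by (rule velocity_eq[OF assms(1,2) assms(3)[unfolded has_real_derivative_iff_has_vector_derivative]])

text \<open>By the mean value theorem a derivative without zeros makes \<open>h\<close> injective.
  The image is connected by continuity and contains two distinct values.\<close>

lemma reparametrization_image:
  assumes I: "nondegenerate_interval I" and smooth: "smooth_curve_on I h"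
    and der: "\<And>s. s \<in> I \<Longrightarrow> (h has_real_derivative h' s) (at s within I)"
    and nz: "\<And>s. s \<in> I \<Longrightarrow> h' s \<noteq> 0"
  shows "reparametrization I (h ` I) h"
proof -
  have int: "is_interval I"
    using I by (simp add: nondegenerate_interval_def)
  have neq: "h a \<noteq> h b" if "a \<in> I" "b \<in> I" "a < b" for a b
  proof -
    have sub: "{a..b} \<subseteq> I"
      using int that by (meson atLeastAtMost_iff mem_is_interval_1_I subsetI)
    have "(h has_derivative (*) (h' s)) (at s within {a..b})" if "a \<le> s" "s \<le> b" for s
    proof -
      have "s \<in> I"
        using sub that by auto
      then show ?thesis
        using has_field_derivative_subset[OF der sub] by (simp add: has_field_derivative_def)
    qed
    then obtain x where "x \<in> {a..b}" "h b - h a = h' x * (b - a)"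
      using mvt_very_simple[of a b h "\<lambda>x. (*) (h' x)"] \<open>a < b\<close> by auto
    then show ?thesis
      using sub nz \<open>a < b\<close> by auto
  qed
  then have inj: "inj_on h I"
    by (metis inj_onI linorder_neqE_linordered_idom)
  have "continuous_on I h"
    using der by (rule DERIV_continuous_on)
  then have intK: "is_interval (h ` I)"
    using int by (simp add: connected_continuous_image is_interval_connected_1)
  obtain a b where ab: "a \<in> I" "b \<in> I" "a < b"
    using nondegenerate_interval_two_points[OF I] .
  \<comment> \<open>The sign of \<open>h'\<close> is unknown, so the two image points may come in
    either order.\<close>
  have "nondegenerate_interval (h ` I)"
    using neq[OF ab] ab(1,2)
      nondegenerate_intervalI[OF intK, of "h a" "h b"] nondegenerate_intervalI[OF intK, of "h b" "h a"]
    by fastforce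
  moreover have "velocity I h s \<noteq> 0" if "s \<in> I" for s
    using velocity_eq_real[OF I that der[OF that]] nz[OF that] by simp
  ultimately show ?thesis
    using I smooth inj unfolding reparametrization_def by (simp add: bij_betw_def)
qed

section \<open>Zeros of solutions of linear homogeneous equations\<close>

text \<open>Integrating factor: for an antiderivative \<open>G\<close> of \<open>g\<close> the
  product of \<open>x\<close> and exp(-G) is constant, and the exponential never vanishes.\<close>

lemma linear_ode_zero_forward:
  fixes x g :: "real \<Rightarrow> real"
  assumes "a \<le> b" "continuous_on {a..b} g"
    and x: "\<And>s. s \<in> {a..b} \<Longrightarrow> (x has_real_derivative g s * x s) (at s within {a..b})"
  shows "x a = 0 \<longleftrightarrow> x b = 0"
proof -
  obtain G where G: "\<And>s. s \<in> {a..b} \<Longrightarrow> (G has_real_derivative g s) (at s within {a..b})"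
    using antiderivative_continuous[OF assms(2)]
    by (auto simp: has_real_derivative_iff_has_vector_derivative)
  have "((\<lambda>s. x s * exp (- G s)) has_real_derivative 0) (at s within {a..b})"
    if "s \<in> {a..b}" for s
    by (rule derivative_eq_intros x G that | simp)+
  then obtain c where c: "\<And>s. s \<in> {a..b} \<Longrightarrow> x s * exp (- G s) = c"
    using has_field_derivative_zero_constant[of "{a..b}" "\<lambda>s. x s * exp (- G s)"] by auto
  show ?thesis
    using c[of a] c[of b] assms(1) by auto
qed

text \<open>\<open>I\<close> may lack end points, so the integrating factor is used on the compact
  segment between the two points, in whichever order they come.\<close>

lemma linear_ode_zero:
  fixes x g :: "real \<Rightarrow> real"
  assumes I: "is_interval I" "s \<in> I" "t \<in> I" and g: "continuous_on I g"
    and x: "\<And>s. s \<in> I \<Longrightarrow> (x has_real_derivative g s * x s) (at s within I)"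
    and "x s = 0"
  shows "x t = 0"
proof -
  have *: "x a = 0 \<longleftrightarrow> x b = 0" if "a \<in> I" "b \<in> I" "a \<le> b" for a b
  proof -
    have sub: "{a..b} \<subseteq> I"
      using I(1) that by (meson atLeastAtMost_iff mem_is_interval_1_I subsetI)
    show ?thesis
      by (rule linear_ode_zero_forward[OF \<open>a \<le> b\<close> continuous_on_subset[OF g sub]])
        (use sub in \<open>auto intro: has_field_derivative_subset[OF x sub]\<close>)
  qed
  show ?thesis
    using *[of s t] *[of t s] I(2,3) \<open>x s = 0\<close> by linarith
qed

section \<open>The TreadmillSled of a ramp\<close>

text \<open>Write T for the unit tangent and N = J T. The Frenet equations T' = k N, N' = -k T give
  x' = k y - 1 and y' = -k x, and the ramp equation reads k R = x/\<mu> + y. In complex notation z =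
  x + i y satisfies \<alpha> = -z T, hence R = |\<alpha>|^2 and \<alpha>' = -conj(z) \<alpha> /
  R.\<close>

lemma ramp_treadmill_sled_odes:
  fixes \<mu> :: real and I :: "real set" and \<alpha> :: "real \<Rightarrow> real \<times> real"
  defines "x \<equiv> \<lambda>s. fst (treadmill_sled I \<alpha> s)" and "y \<equiv> \<lambda>s. snd (treadmill_sled I \<alpha> s)"
  defines "R \<equiv> \<lambda>s. (x s)\<^sup>2 + (y s)\<^sup>2"
  assumes \<mu>: "\<mu> > 0" and ramp: "inverse_oscillator_ramp 1 \<mu> I \<alpha>" and s: "s \<in> I"
  shows "R s = (fst (\<alpha> s))\<^sup>2 + (snd (\<alpha> s))\<^sup>2" "R s > 0" "x s \<ge> 0"
    and "(x has_real_derivative x s * (y s / \<mu> - x s) / R s) (at s within I)"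
    and "(y has_real_derivative - x s * (x s / \<mu> + y s) / R s) (at s within I)"
    and "((\<lambda>s. fst (\<alpha> s)) has_real_derivative - (x s * fst (\<alpha> s) + y s * snd (\<alpha> s)) / R s) (at s within I)"
    and "((\<lambda>s. snd (\<alpha> s)) has_real_derivative (y s * fst (\<alpha> s) - x s * snd (\<alpha> s)) / R s) (at s within I)"
proof -
  have arc: "arclength_curve I \<alpha>"
    and ramp': "\<And>s. s \<in> I \<Longrightarrow> \<alpha> s \<bullet> velocity I \<alpha> s \<le> 0"
      "\<And>s. s \<in> I \<Longrightarrow> curvature I \<alpha> s = - (1 / (norm (\<alpha> s))\<^sup>2) *
            ((\<alpha> s \<bullet> velocity I \<alpha> s) / \<mu> + \<alpha> s \<bullet> unit_normal I \<alpha> s)"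
    using ramp unfolding inverse_oscillator_ramp_def by auto
  have I: "nondegenerate_interval I" and \<alpha>0: "\<alpha> s \<noteq> 0"
    and unit: "\<And>s. s \<in> I \<Longrightarrow> norm (velocity I \<alpha> s) = 1"
    using arc s unfolding arclength_curve_def by auto
  obtain D where D0: "\<And>s. s \<in> I \<Longrightarrow> D 0 s = \<alpha> s"
    and D: "\<And>n s. s \<in> I \<Longrightarrow> (D n has_vector_derivative D (Suc n) s) (at s within I)"
    using arc unfolding arclength_curve_def smooth_curve_on_def by metis
  have d\<alpha>: "(\<alpha> has_vector_derivative D 1 s) (at s within I)" if "s \<in> I" for s
    using D[OF that, of 0] has_vector_derivative_transform[OF that, of \<alpha> "D 0"] D0 by simp
  have vel: "velocity I \<alpha> s = D 1 s" if "s \<in> I" for s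
    using velocity_eq[OF I that d\<alpha>[OF that]] .
  have dvel: "(velocity I \<alpha> has_vector_derivative D 2 s) (at s within I)"
    using D[OF s, of 1] has_vector_derivative_transform[OF s, of "velocity I \<alpha>" "D 1"] vel
    by (simp add: numeral_2_eq_2)
  have acc: "velocity I (velocity I \<alpha>) s = D 2 s"
    using velocity_eq[OF I s dvel] .
  define p q where "p s = fst (\<alpha> s)" and "q s = snd (\<alpha> s)" for s
  define P Q where "P s = fst (velocity I \<alpha> s)" and "Q s = snd (velocity I \<alpha> s)" for s
  define P' Q' where "P' = fst (D 2 s)" and "Q' = snd (D 2 s)"
  note fst_der = bounded_linear.has_vector_derivative[OF bounded_linear_fst]
    and snd_der = bounded_linear.has_vector_derivative[OF bounded_linear_snd]
  have dp: "(p has_real_derivative P s) (at s within I)"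
    and dq: "(q has_real_derivative Q s) (at s within I)"
    using fst_der[OF d\<alpha>[OF s]] snd_der[OF d\<alpha>[OF s]] vel[OF s]
    by (simp_all add: p_def[abs_def] q_def[abs_def] P_def Q_def
        has_real_derivative_iff_has_vector_derivative)
  have dP: "(P has_real_derivative P') (at s within I)"
    and dQ: "(Q has_real_derivative Q') (at s within I)"
    using fst_der[OF dvel] snd_der[OF dvel]
    by (simp_all add: P_def[abs_def] Q_def[abs_def] P'_def Q'_def
        has_real_derivative_iff_has_vector_derivative)
  have PQ1: "(P s)\<^sup>2 + (Q s)\<^sup>2 = 1" if "s \<in> I" for s
    using unit[OF that] by (simp add: P_def Q_def norm_prod_def)
  have "((\<lambda>s. (P s)\<^sup>2 + (Q s)\<^sup>2) has_real_derivative 2 * (P s * P' + Q s * Q')) (at s within I)"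
    by (rule derivative_eq_intros dP dQ refl)+ (simp add: algebra_simps)
  \<comment> \<open>The squared speed is 1 on \<open>I\<close>; uniqueness of the derivative then
    makes T' orthogonal to T.\<close>
  then have "((\<lambda>_. 1) has_real_derivative 2 * (P s * P' + Q s * Q')) (at s within I)"
    by (rule has_field_derivative_transform_within[OF _ zero_less_one s]) (simp add: PQ1)
  then have orth: "P s * P' + Q s * Q' = 0"
    using velocity_eq_real[OF I s] velocity_eq_real[OF I s DERIV_const, of 1] by fastforce
  define k where "k = curvature I \<alpha> s"
  have k: "k = P s * Q' - Q s * P'"
    by (simp add: k_def curvature_def unit_normal_def J_def acc inner_prod_def P'_def Q'_def P_def Q_def)
  \<comment> \<open>Being orthogonal to the unit vector T, the vector T' equals its normal component
    k N.\<close>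
  have frenet: "P' = - k * Q s" "Q' = k * P s"
    using k orth PQ1[OF s] by algebra+
  have x: "x s = - (p s * P s + q s * Q s)" and y: "y s = p s * Q s - q s * P s" for s
    by (simp_all add: x_def y_def treadmill_sled_def unit_normal_def J_def inner_prod_def
        p_def q_def P_def Q_def)
  show R: "R s = (fst (\<alpha> s))\<^sup>2 + (snd (\<alpha> s))\<^sup>2"
    using PQ1[OF s] unfolding R_def x y p_def[symmetric] q_def[symmetric] by algebra
  then have Rpq: "R s = (p s)\<^sup>2 + (q s)\<^sup>2"
    by (simp add: p_def q_def)
  show R0: "R s > 0"
    using \<alpha>0 R by (simp add: prod_eq_iff sum_power2_gt_zero_iff)
  show "x s \<ge> 0"
    using ramp'(1)[OF s] by (simp add: x_def treadmill_sled_def)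
  have "(norm (\<alpha> s))\<^sup>2 = R s"
    using R by (simp add: norm_prod_def)
  then have kR: "k * R s = x s / \<mu> + y s"
    using ramp'(2)[OF s] R0
    by (simp add: k_def x_def y_def treadmill_sled_def field_simps)
  have "(x has_real_derivative k * y s - 1) (at s within I)"
    unfolding x[abs_def] y
    by (rule derivative_eq_intros dp dq dP dQ refl)+
      (use frenet PQ1[OF s] in \<open>simp, algebra\<close>)
  \<comment> \<open>After multiplication by R the terms in y^2 cancel against R = x^2 + y^2.\<close>
  moreover have "k * y s - 1 = x s * (y s / \<mu> - x s) / R s"
  proof -
    have "(k * y s - 1) * R s = (k * R s) * y s - R s"
      by (simp add: algebra_simps)
    also have "\<dots> = x s * (y s / \<mu> - x s)"
      unfolding kR by (simp add: R_def algebra_simps power2_eq_square)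
    finally show ?thesis
      using R0 by (simp add: eq_divide_eq)
  qed
  ultimately show "(x has_real_derivative x s * (y s / \<mu> - x s) / R s) (at s within I)"
    by simp
  have "(y has_real_derivative - k * x s) (at s within I)"
    unfolding y[abs_def] x
    by (rule derivative_eq_intros dp dq dP dQ refl)+
      (simp add: frenet algebra_simps)
  moreover have "- k * x s = - x s * (x s / \<mu> + y s) / R s"
    unfolding kR[symmetric] using R0 by simp
  ultimately show "(y has_real_derivative - x s * (x s / \<mu> + y s) / R s) (at s within I)"
    by simp
  \<comment> \<open>These are the components of |\<alpha>|^2 T = -conj(z) \<alpha>, which follows
    from z = -\<alpha> conj(T).\<close>
  have "P s * R s = - (x s * p s + y s * q s)" "Q s * R s = y s * p s - x s * q s"
    unfolding Rpq x y by algebra+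
  then have "P s = - (x s * p s + y s * q s) / R s" "Q s = (y s * p s - x s * q s) / R s"
    using R0 by (simp_all add: eq_divide_eq)
  then show "((\<lambda>s. fst (\<alpha> s)) has_real_derivative - (x s * fst (\<alpha> s) + y s * snd (\<alpha> s)) / R s) (at s within I)"
    "((\<lambda>s. snd (\<alpha> s)) has_real_derivative (y s * fst (\<alpha> s) - x s * snd (\<alpha> s)) / R s) (at s within I)"
    using dp dq by (simp_all add: p_def[abs_def] q_def[abs_def])
qed

text \<open>Along the given curve the equation for x reads x' = g x with the continuous coefficient
  g = (y/\<mu> - x)/R, so one zero of x spreads over \<open>I\<close>. Then y' vanishes too, and R >
  0 keeps the constant away from 0.\<close>

lemma ramp_treadmill_sled_constant:
  fixes \<mu> :: real and I :: "real set" and \<alpha> :: "real \<Rightarrow> real \<times> real"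
  assumes \<mu>: "\<mu> > 0" and ramp: "inverse_oscillator_ramp 1 \<mu> I \<alpha>"
    and s0: "s0 \<in> I" "fst (treadmill_sled I \<alpha> s0) = 0"
  shows "\<exists>a. a \<noteq> 0 \<and> (\<forall>s\<in>I. treadmill_sled I \<alpha> s = (0, a))"
proof -
  define x y where "x s = fst (treadmill_sled I \<alpha> s)" and "y s = snd (treadmill_sled I \<alpha> s)" for s
  define R where "R s = (x s)\<^sup>2 + (y s)\<^sup>2" for s
  note odes = ramp_treadmill_sled_odes[OF \<mu> ramp, folded x_def y_def, folded R_def]
  have int: "is_interval I"
    using ramp by (simp add: inverse_oscillator_ramp_def arclength_curve_def nondegenerate_interval_def)
  have cont: "continuous_on I x" "continuous_on I y"
    using DERIV_continuous_on[OF odes(4)] DERIV_continuous_on[OF odes(5)] by blast+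
  moreover have "R s \<noteq> 0" if "s \<in> I" for s
    using odes(2)[OF that] by simp
  ultimately have "continuous_on I (\<lambda>s. (y s / \<mu> - x s) / R s)"
    unfolding R_def using \<mu> by (auto intro!: continuous_intros)
  then have x0: "x s = 0" if "s \<in> I" for s
    by (rule linear_ode_zero[OF int s0(1) that])
      (use odes(4) s0(2) in \<open>auto simp: x_def mult.commute\<close>)
  have "(y has_real_derivative 0) (at s within I)" if "s \<in> I" for s
    using odes(5)[OF that] x0[OF that] by simp
  then obtain a where a: "\<And>s. s \<in> I \<Longrightarrow> y s = a"
    using has_field_derivative_zero_constant[of I y] int by (auto simp: is_interval_convex_1)
  moreover have "a \<noteq> 0"
    using odes(2)[OF s0(1)] x0[OF s0(1)] a[OF s0(1)] by (simp add: R_def)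
  ultimately show ?thesis
    using x0 by (intro exI[of _ a]) (auto simp: prod_eq_iff x_def y_def)
qed

text \<open>On a spiral the norm determines the polar angle, and the angle is injective in the
  parameter. This keeps the two alternatives of the theorem disjoint.\<close>

lemma not_part_of_log_spiral_constant:
  assumes "nondegenerate_interval I" "\<And>s. s \<in> I \<Longrightarrow> \<gamma> s = p"
  shows "\<not> part_of_log_spiral I \<gamma>"
proof
  assume "part_of_log_spiral I \<gamma>"
  then obtain c b K \<theta> where c: "c > 0" "b \<noteq> 0" and r: "reparametrization I K \<theta>"
    and g: "\<And>s. s \<in> I \<Longrightarrow> \<gamma> s = log_spiral c b (\<theta> s)"
    unfolding part_of_log_spiral_def by blast
  have norm: "norm (log_spiral c b t) = c * exp (b * t)" for t
    using c by (simp add: log_spiral_def norm_prod_def power_mult_distrib real_sqrt_mult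
        flip: distrib_left)
  obtain s t where st: "s \<in> I" "t \<in> I" "s < t"
    using nondegenerate_interval_two_points[OF assms(1)] .
  have "c * exp (b * \<theta> s) = c * exp (b * \<theta> t)"
    using g assms(2) st norm by metis
  then have "\<theta> s = \<theta> t"
    using c by simp
  then show False
    using r st by (auto simp: reparametrization_def bij_betw_def dest: inj_onD)
qed

section \<open>Logarithmic spirals and the model ramp\<close>

text \<open>With x > 0 the TreadmillSled stays in the right half-plane, where arctan (y/x) is a
  global polar angle. This one angle gives both the spiral, of growth rate \<mu>, and the parameter
  of the model ramp.\<close>

lemma ramp_log_spiral:
  fixes \<mu> :: real and I :: "real set" and \<alpha> :: "real \<Rightarrow> real \<times> real"
  assumes \<mu>: "\<mu> > 0" and ramp: "inverse_oscillator_ramp 1 \<mu> I \<alpha>"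
    and nz: "\<And>s. s \<in> I \<Longrightarrow> fst (treadmill_sled I \<alpha> s) \<noteq> 0"
  shows "part_of_log_spiral I (treadmill_sled I \<alpha>)"
    and "\<exists>\<phi> r K h. r > 0 \<and> K \<subseteq> {- (pi/2)<..<pi/2} \<and>
              orientation_preserving_reparametrization I K h \<and>
              (\<forall>s\<in>I. \<alpha> s = rotation \<phi> (r *\<^sub>R model_ramp \<mu> pi (h s)))"
proof -
  define x y where "x s = fst (treadmill_sled I \<alpha> s)" and "y s = snd (treadmill_sled I \<alpha> s)" for s
  define R where "R s = (x s)\<^sup>2 + (y s)\<^sup>2" for s
  define p q where "p s = fst (\<alpha> s)" and "q s = snd (\<alpha> s)" for s
  note odes = ramp_treadmill_sled_odes[OF \<mu> ramp, folded x_def y_def p_def q_def, folded R_def]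
  have I: "nondegenerate_interval I"
    using ramp by (simp add: inverse_oscillator_ramp_def arclength_curve_def)
  then have conv: "convex I"
    by (simp add: nondegenerate_interval_def is_interval_convex_1)
  have xpos: "x s > 0" if "s \<in> I" for s
    using odes(3)[OF that] nz[OF that] by (simp add: x_def)
  \<comment> \<open>In 2 (x x' + y y') the terms with 1/\<mu> cancel, and the rest is -2 x (x^2 +
    y^2) / R.\<close>
  have dR: "(R has_real_derivative - 2 * x s) (at s within I)" if "s \<in> I" for s
    unfolding R_def
    by (rule derivative_eq_intros odes(4,5) that refl)+
      (use odes(2)[OF that] in \<open>simp add: field_simps, simp add: R_def field_simps power2_eq_square\<close>)

  define \<theta> where "\<theta> s = arctan (y s / x s)" for s
  have tan: "tan (\<theta> s) = y s / x s" for s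
    by (simp add: \<theta>_def tan_arctan)
  have range: "- (pi/2) < \<theta> s" "\<theta> s < pi/2" for s
    using arctan_bounded[of "y s / x s"] by (auto simp: \<theta>_def)
  have cos0: "cos (\<theta> s) > 0" for s
    using range by (intro cos_gt_zero_pi)
  have polar: "x s = sqrt (R s) * cos (\<theta> s)" "y s = sqrt (R s) * sin (\<theta> s)" if "s \<in> I" for s
  proof -
    have "1 + (y s / x s)\<^sup>2 = R s / (x s)\<^sup>2"
      using xpos[OF that] by (simp add: R_def field_simps)
    then have "sqrt (1 + (y s / x s)\<^sup>2) = sqrt (R s) / x s"
      using xpos[OF that] by (simp add: real_sqrt_divide)
    then show "x s = sqrt (R s) * cos (\<theta> s)" "y s = sqrt (R s) * sin (\<theta> s)"
      using xpos[OF that] odes(2)[OF that]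
      by (simp_all add: \<theta>_def cos_arctan sin_arctan)
  qed
  have d\<theta>: "(\<theta> has_real_derivative - x s / (\<mu> * R s)) (at s within I)" if "s \<in> I" for s
  proof -
    have "((\<lambda>s. arctan (y s / x s)) has_real_derivative
        inverse (1 + (y s / x s)\<^sup>2) *
        (((- x s * (x s / \<mu> + y s) / R s) * x s - y s * (x s * (y s / \<mu> - x s) / R s)) / (x s * x s)))
        (at s within I)"
      using xpos[OF that]
      by (intro DERIV_chain2[OF DERIV_arctan] DERIV_divide odes(4,5) that) simp
    moreover have "inverse (1 + (y s / x s)\<^sup>2) = (x s)\<^sup>2 / R s"
      using xpos[OF that] by (simp add: R_def field_simps)
    \<comment> \<open>In the numerator x y' - y x' the terms x^2 y cancel, which leaves a multiple
      of x^2 + y^2 = R. Both sides are put over R so that only numerators are compared.\<close>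
    moreover have "(- x s * (x s / \<mu> + y s) / R s) * x s - y s * (x s * (y s / \<mu> - x s) / R s)
        = - x s / \<mu>"
    proof -
      have "(- x s * (x s / \<mu> + y s) / R s) * x s - y s * (x s * (y s / \<mu> - x s) / R s)
          = - x s / \<mu> * R s / R s"
        unfolding diff_divide_distrib[symmetric] times_divide_eq_left times_divide_eq_right
        by (rule arg_cong[of _ _ "\<lambda>t. t / R s"]) (simp add: R_def[of s] algebra_simps power2_eq_square add_divide_distrib diff_divide_distrib)
      then show ?thesis
        using odes(2)[OF that] by simp
    qed
    ultimately show ?thesis
      using xpos[OF that] unfolding \<theta>_def by (simp add: power2_eq_square mult.commute)
  qed

  have smooth: "smooth_curve_on I (\<lambda>s. - x s / (\<mu> * R s))"
  proof -
    \<comment> \<open>Adjoining w = 1/R makes the system polynomial, with w' = 2 x w^2.\<close>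
    define w where "w s = inverse (R s)" for s
    let ?P = "polynomials_in {x, y, w}"
    have dw: "(w has_real_derivative 2 * x s * (w s * w s)) (at s within I)" if "s \<in> I" for s
      unfolding w_def
      by (rule derivative_eq_intros dR that refl)+
        (use odes(2)[OF that] in \<open>auto simp: power2_eq_square\<close>)
    \<comment> \<open>Differences and divisions by \<mu> are written with constant factors to match
      the rules of \<open>polynomials_in\<close>.\<close>
    have poly: "(\<lambda>s. x s * ((1 / \<mu>) * y s + (- 1) * x s) * w s) \<in> ?P"
      "(\<lambda>s. (- 1) * x s * ((1 / \<mu>) * x s + y s) * w s) \<in> ?P"
      "(\<lambda>s. 2 * x s * (w s * w s)) \<in> ?P" "(\<lambda>s. (- 1 / \<mu>) * (x s * w s)) \<in> ?P"
      by (intro polynomials_in.intros; simp)+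
    have "smooth_curve_on I (\<lambda>s. (- 1 / \<mu>) * (x s * w s))"
    proof (rule smooth_curve_on_polynomials_in[OF _ poly(4)])
      fix g assume "g \<in> {x, y, w}"
      then consider "g = x" | "g = y" | "g = w" by blast
      then show "\<exists>g'\<in>?P. \<forall>s\<in>I. (g has_real_derivative g' s) (at s within I)"
      proof cases
        case 1
        then show ?thesis
          using odes(4) by (intro bexI[OF _ poly(1)]) (simp add: w_def field_simps)
      next
        case 2
        then show ?thesis
          using odes(5) by (intro bexI[OF _ poly(2)]) (simp add: w_def field_simps)
      next
        case 3
        then show ?thesis
          using dw by (intro bexI[OF _ poly(3)]) simp
      qed
    qed
    then show ?thesis
      by (simp add: w_def field_simps)
  qed
  then have smooth\<theta>: "smooth_curve_on I \<theta>"
    by (rule smooth_curve_on_antiderivative)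
      (use d\<theta> in \<open>simp add: has_real_derivative_iff_has_vector_derivative\<close>)
  have d\<theta>0: "- x s / (\<mu> * R s) < 0" if "s \<in> I" for s
    using xpos[OF that] odes(2)[OF that] \<mu> by simp
  have rep\<theta>: "reparametrization I (\<theta> ` I) \<theta>"
    using reparametrization_image[OF I smooth\<theta> d\<theta>] d\<theta>0 by (metis less_irrefl)

  \<comment> \<open>First integral: R'/R = -2 x / R = 2 \<mu> \<theta>'.\<close>
  have "((\<lambda>s. R s * exp (- (2 * \<mu> * \<theta> s))) has_real_derivative 0) (at s within I)" if "s \<in> I" for s
    by (rule derivative_eq_intros dR d\<theta> that refl)+
      (use odes(2)[OF that] \<mu> in \<open>simp add: field_simps\<close>)
  then obtain C where C: "\<And>s. s \<in> I \<Longrightarrow> R s * exp (- (2 * \<mu> * \<theta> s)) = C"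
    using has_field_derivative_zero_constant[OF conv, of "\<lambda>s. R s * exp (- (2 * \<mu> * \<theta> s))"] by auto
  obtain s0 where s0: "s0 \<in> I"
    using nondegenerate_interval_two_points[OF I] .
  define c where "c = sqrt C"
  have c: "c > 0"
    using C[OF s0] odes(2)[OF s0] by (auto simp: c_def)
  have R: "sqrt (R s) = c * exp (\<mu> * \<theta> s)" if "s \<in> I" for s
  proof -
    have "R s = C * exp (2 * \<mu> * \<theta> s)"
      using C[OF that] by (simp add: exp_minus field_simps)
    also have "\<dots> = C * (exp (\<mu> * \<theta> s))\<^sup>2"
      by (simp add: power2_eq_square flip: exp_add)
    finally show ?thesis
      by (simp add: real_sqrt_mult c_def)
  qed
  have "treadmill_sled I \<alpha> s = log_spiral c \<mu> (\<theta> s)" if "s \<in> I" for s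
    using polar[OF that] R[OF that] by (simp add: log_spiral_def prod_eq_iff x_def y_def)
  with c \<mu> rep\<theta> show "part_of_log_spiral I (treadmill_sled I \<alpha>)"
    unfolding part_of_log_spiral_def by (metis less_irrefl)

  \<comment> \<open>\<theta> decreases along the ramp, so its negative preserves
    orientation.\<close>
  define h where "h s = - \<theta> s" for s
  have dh: "(h has_real_derivative x s / (\<mu> * R s)) (at s within I)" if "s \<in> I" for s
    using DERIV_minus[OF d\<theta>[OF that]] by (simp add: h_def[abs_def])
  have "smooth_curve_on I h"
  proof -
    obtain D where "\<forall>s\<in>I. D 0 s = \<theta> s"
      "\<forall>n. \<forall>s\<in>I. (D n has_vector_derivative D (Suc n) s) (at s within I)"
      using smooth\<theta> unfolding smooth_curve_on_def by blast
    then show ?thesis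
      unfolding smooth_curve_on_def h_def
      by (intro exI[of _ "\<lambda>n s. - D n s"]) (auto intro: has_vector_derivative_minus)
  qed
  then have "reparametrization I (h ` I) h"
    using reparametrization_image[OF I _ dh] d\<theta>0 by force
  moreover have "velocity I h s > 0" if "s \<in> I" for s
    using velocity_eq_real[OF I that dh[OF that]] d\<theta>0[OF that] by simp
  ultimately have reph: "orientation_preserving_reparametrization I (h ` I) h"
    by (simp add: orientation_preserving_reparametrization_def)

  text \<open>In complex notation, \<open>A + i B\<close> is \<open>\<alpha> e\<^bsup>- i f\<^esup> e\<^bsup>- \<mu> \<theta>\<^esup>\<close>.\<close>
  define f where "f s = \<mu> * ln (cos (\<theta> s))" for s
  define E where "E s = exp (- (\<mu> * \<theta> s))" for s
  define A B where "A s = (p s * cos (f s) + q s * sin (f s)) * E s"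
    and "B s = (q s * cos (f s) - p s * sin (f s)) * E s" for s
  \<comment> \<open>By \<alpha>' = (-x + i y) \<alpha> / R, the polar angle of \<alpha> turns at the
    rate y/R; \<open>f\<close> is an antiderivative of this rate.\<close>
  have df: "(f has_real_derivative y s / R s) (at s within I)" if "s \<in> I" for s
  proof -
    have "(f has_real_derivative \<mu> * (- sin (\<theta> s) * (- x s / (\<mu> * R s)) / cos (\<theta> s))) (at s within I)"
      unfolding f_def by (rule derivative_eq_intros d\<theta> that refl cos0)+ simp
    moreover have "\<mu> * (- sin (\<theta> s) * (- x s / (\<mu> * R s)) / cos (\<theta> s)) = tan (\<theta> s) * x s / R s"
      using \<mu> by (simp add: tan_def)
    ultimately show ?thesis
      using xpos[OF that] by (simp add: tan)
  qed
  have dE: "(E has_real_derivative x s / R s * E s) (at s within I)" if "s \<in> I" for s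
    unfolding E_def by (rule derivative_eq_intros d\<theta> that refl)+ (use \<mu> in simp)
  \<comment> \<open>The rotation by -f cancels the part i y / R of \<alpha>'/\<alpha>, and the
    factor \<open>E\<close>, with E'/E = x/R, cancels -x/R.\<close>
  have dA: "(A has_real_derivative 0) (at s within I)"
    and dB: "(B has_real_derivative 0) (at s within I)" if "s \<in> I" for s
    unfolding A_def B_def
    by ((rule derivative_eq_intros odes(6,7) df dE that refl)+,
        use odes(2)[OF that] in \<open>simp add: field_simps\<close>)+
  obtain a b where A: "\<And>s. s \<in> I \<Longrightarrow> A s = a" and B: "\<And>s. s \<in> I \<Longrightarrow> B s = b"
    using has_field_derivative_zero_constant[OF conv dA] has_field_derivative_zero_constant[OF conv dB]
    by metis
  \<comment> \<open>Undoing rotation and scaling gives \<alpha> = (a + i b) exp (i f) exp (\<mu>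
    \<theta>).\<close>
  have pq: "p s = (cos (f s) * a - sin (f s) * b) * exp (\<mu> * \<theta> s)"
    "q s = (sin (f s) * a + cos (f s) * b) * exp (\<mu> * \<theta> s)" if "s \<in> I" for s
  proof -
    have "E s * exp (\<mu> * \<theta> s) = 1"
      by (simp add: E_def flip: exp_add)
    moreover have "(cos (f s))\<^sup>2 + (sin (f s))\<^sup>2 = 1"
      by simp
    ultimately show "p s = (cos (f s) * a - sin (f s) * b) * exp (\<mu> * \<theta> s)"
      "q s = (sin (f s) * a + cos (f s) * b) * exp (\<mu> * \<theta> s)"
      unfolding A[OF that, symmetric] B[OF that, symmetric] A_def B_def by algebra+
  qed
  \<comment> \<open>Comparing |\<alpha>|^2 with |z|^2 at one point gives |a + i b| = c: the dilation
    factor is the spiral's own constant, and the argument of a + i b is the rotation angle.\<close>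
  have "R s0 = (a\<^sup>2 + b\<^sup>2) * (exp (\<mu> * \<theta> s0))\<^sup>2"
  proof -
    have "(cos (f s0))\<^sup>2 + (sin (f s0))\<^sup>2 = 1"
      by simp
    then show ?thesis
      unfolding odes(1)[OF s0] pq[OF s0] by algebra
  qed
  moreover have "R s0 = c\<^sup>2 * (exp (\<mu> * \<theta> s0))\<^sup>2"
    using arg_cong[OF R[OF s0], of power2] odes(2)[OF s0] by (simp add: power_mult_distrib)
  ultimately have "a\<^sup>2 + b\<^sup>2 = c\<^sup>2"
    by simp
  then have "(a / c)\<^sup>2 + (b / c)\<^sup>2 = 1"
    using c by (simp add: power_divide flip: add_divide_distrib)
  then obtain \<phi> where "a / c = cos \<phi>" "b / c = sin \<phi>"
    using sincos_total_2pi by metis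
  then have \<phi>: "a = c * cos \<phi>" "b = c * sin \<phi>"
    using c by (simp_all add: field_simps)
  \<comment> \<open>For u = pi the quotient cos (t + u) / cos u is cos t. At t = -\<theta> the model
    angle is therefore \<open>f s\<close> and the radial factor is exp (\<mu> \<theta>).\<close>
  have "\<alpha> s = rotation \<phi> (c *\<^sub>R model_ramp \<mu> pi (h s))" if "s \<in> I" for s
    using pq[OF that]
    by (simp add: prod_eq_iff rotation_def model_ramp_def h_def \<phi> p_def q_def
        flip: f_def) (simp add: algebra_simps)
  with c reph range show "\<exists>\<phi> r K h. r > 0 \<and> K \<subseteq> {- (pi/2)<..<pi/2} \<and>
              orientation_preserving_reparametrization I K h \<and>
              (\<forall>s\<in>I. \<alpha> s = rotation \<phi> (r *\<^sub>R model_ramp \<mu> pi (h s)))"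
    by (intro exI[of _ \<phi>] exI[of _ c] exI[of _ "h ` I"] exI[of _ h])
      (auto simp: h_def minus_less_iff less_minus_iff)
qed

theorem theorem3p3:
  fixes \<mu> :: real and I :: "real set" and \<alpha> :: "real \<Rightarrow> real \<times> real"
  assumes "\<mu> > 0"
    and "inverse_oscillator_ramp 1 \<mu> I \<alpha>"
  shows "((\<exists>a. a \<noteq> 0 \<and> (\<forall>s\<in>I. treadmill_sled I \<alpha> s = (0, a))) \<or>
          part_of_log_spiral I (treadmill_sled I \<alpha>)) \<and>
         (part_of_log_spiral I (treadmill_sled I \<alpha>) \<longrightarrow>
           (\<exists>u \<in> {pi/2<..<3*pi/2}. \<exists>\<phi> r K h.
              r > 0 \<and> K \<subseteq> {pi/2 - u<..<3*pi/2 - u} \<and>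
              orientation_preserving_reparametrization I K h \<and>
              (\<forall>s\<in>I. \<alpha> s = rotation \<phi> (r *\<^sub>R model_ramp \<mu> u (h s)))))"
proof (cases "\<exists>s\<in>I. fst (treadmill_sled I \<alpha> s) = 0")
  case True
  then obtain a where a: "a \<noteq> 0" "\<forall>s\<in>I. treadmill_sled I \<alpha> s = (0, a)"
    using ramp_treadmill_sled_constant[OF assms] by blast
  have "nondegenerate_interval I"
    using assms(2) by (simp add: inverse_oscillator_ramp_def arclength_curve_def)
  \<comment> \<open>This makes the implication of the second conjunct vacuous.\<close>
  then have "\<not> part_of_log_spiral I (treadmill_sled I \<alpha>)"
    using a(2) by (intro not_part_of_log_spiral_constant) auto
  with a show ?thesis by blast
next
  case False
  then have nz: "\<And>s. s \<in> I \<Longrightarrow> fst (treadmill_sled I \<alpha> s) \<noteq> 0"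
    by blast
  \<comment> \<open>For the witness u = pi the model interval is exactly the range of the
    arctangent.\<close>
  have "{pi/2 - pi<..<3*pi/2 - pi} = {- (pi/2)<..<pi/2}"
    by (auto simp: field_simps)
  moreover have "pi \<in> {pi/2<..<3*pi/2}"
    using pi_gt_zero by simp
  ultimately show ?thesis
    using ramp_log_spiral[OF assms nz] by (intro conjI disjI2 impI bexI[of _ pi]) simp_all
qed

end
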